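(* Let $k$ be an algebraically closed field with $\operatorname{char}(k)\neq 2$. For every $n\ge 2$, the variety $\mathrm{Salg}_n$ of $n$-dimensional superalgebras over $k$ is disconnected.
   Context: A superalgebra is a $\mathbb{Z}_2$-graded associative unital algebra $A=A_0\oplus A_1$ over $k$; equivalently an algebra $A$ with an algebra automorphism $\sigma$ satisfying $\sigma^2=\mathrm{id}$ ($\sigma=1$ on $A_0$, $\sigma=-1$ on $A_1$). $\mathrm{Salg}_n\subseteq\mathbb{A}^{n^3+n^2}$ is the set of all $(\alpha^h_{ij},\gamma^j_i)_{1\le i,j,h\le n}$ such that $e_ie_j=\sum_h\alpha^h_{ij}e_h$ defines an associative algebra structure on $k^n$ (standard basis $e_1,\dots,e_n$) with identity $e_1$, and $\sigma(e_i)=\sum_j\gamma^j_ie_j$ defines an algebra automorphism with $\sigma^2=\mathrm{id}$. It is a Zariski closed subset of $\mathbb{A}^{n^3+n^2}$ and carries the Zariski topology. *)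

theory Defs
  imports
    "HOL-Analysis.Abstract_Topology"
    "HOL-Algebra.QuotRing"
    "HOL-Library.Poly_Mapping"
    "HOL-Computational_Algebra.Polynomial"
begin

text \<open>
  Multivariate polynomials with variables in \<open>'v\<close> and coefficients in \<open>'k\<close> are the elements of
  the ring \<open>('v \<Rightarrow>\<^sub>0 nat) \<Rightarrow>\<^sub>0 'k\<close>: finitely supported families of coefficients, indexed by
  exponent vectors.
\<close>

type_synonym ('v, 'k) mpoly = "('v \<Rightarrow>\<^sub>0 nat) \<Rightarrow>\<^sub>0 'k"

definition monom_eval :: "('v \<Rightarrow>\<^sub>0 nat) \<Rightarrow> ('v \<Rightarrow> 'k::comm_semiring_1) \<Rightarrow> 'k" where
  "monom_eval m x = (\<Prod>v\<in>Poly_Mapping.keys m. x v ^ Poly_Mapping.lookup m v)"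

definition mpoly_eval :: "('v, 'k::comm_semiring_1) mpoly \<Rightarrow> ('v \<Rightarrow> 'k) \<Rightarrow> 'k" where
  "mpoly_eval p x = (\<Sum>m\<in>Poly_Mapping.keys p. Poly_Mapping.lookup p m * monom_eval m x)"

definition mpolys :: "'v set \<Rightarrow> ('v, 'k::zero) mpoly set" where
  "mpolys I = {p. \<forall>m\<in>Poly_Mapping.keys p. Poly_Mapping.keys m \<subseteq> I}"

text \<open>
  Points of an affine space with coordinates indexed by \<open>I\<close> are extensional functions on \<open>I\<close>, so
  that two points are equal iff their coordinates are.
\<close>

definition affine_space :: "'v set \<Rightarrow> ('v \<Rightarrow> 'k) set" where
  "affine_space I = I \<rightarrow>\<^sub>E UNIV"

definition zero_locus :: "'v set \<Rightarrow> ('v, 'k::comm_semiring_1) mpoly set \<Rightarrow> ('v \<Rightarrow> 'k) set" where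
  "zero_locus I S = {x \<in> affine_space I. \<forall>p\<in>S. mpoly_eval p x = 0}"

definition zariski_topology :: "'v set \<Rightarrow> ('v \<Rightarrow> 'k::field) topology" where
  "zariski_topology I = topology (\<lambda>U. \<exists>S \<subseteq> mpolys I. U = affine_space I - zero_locus I S)"

lemma monom_eval_superset:
  assumes "finite A" "Poly_Mapping.keys m \<subseteq> A"
  shows "monom_eval m x = (\<Prod>v\<in>A. x v ^ Poly_Mapping.lookup m v)"
  unfolding monom_eval_def
  by (rule prod.mono_neutral_left) (use assms in \<open>auto simp: in_keys_iff\<close>)

lemma monom_eval_add: "monom_eval (m + m') x = monom_eval m x * monom_eval m' x"
proof -
  let ?A = "Poly_Mapping.keys m \<union> Poly_Mapping.keys m'"
  have "Poly_Mapping.keys (m + m') \<subseteq> ?A"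
    by (rule keys_add)
  then show ?thesis
    by (simp add: monom_eval_superset[of ?A] lookup_add power_add prod.distrib)
qed

lemma mpoly_eval_superset:
  assumes "finite A" "Poly_Mapping.keys p \<subseteq> A"
  shows "mpoly_eval p x = (\<Sum>m\<in>A. Poly_Mapping.lookup p m * monom_eval m x)"
  unfolding mpoly_eval_def
  by (rule sum.mono_neutral_left) (use assms in \<open>auto simp: in_keys_iff\<close>)

lemma mpoly_eval_zero [simp]: "mpoly_eval 0 x = 0"
  by (simp add: mpoly_eval_def)

lemma mpoly_eval_single [simp]:
  "mpoly_eval (Poly_Mapping.single m c) x = c * monom_eval m x"
  by (subst mpoly_eval_superset[of "{m}"]) auto

lemma mpoly_eval_one [simp]: "mpoly_eval 1 x = 1"
  by (simp add: mpoly_eval_def monom_eval_def)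

lemma mpoly_eval_add: "mpoly_eval (p + q) x = mpoly_eval p x + mpoly_eval q x"
proof -
  let ?A = "Poly_Mapping.keys p \<union> Poly_Mapping.keys q"
  have "Poly_Mapping.keys (p + q) \<subseteq> ?A"
    by (rule keys_add)
  then show ?thesis
    by (simp add: mpoly_eval_superset[of ?A] lookup_add algebra_simps sum.distrib)
qed

lemma mpoly_eval_sum: "mpoly_eval (\<Sum>i\<in>A. f i) x = (\<Sum>i\<in>A. mpoly_eval (f i) x)"
  by (induction A rule: infinite_finite_induct) (auto simp: mpoly_eval_add)

lemma mpoly_as_sum:
  "p = (\<Sum>m\<in>Poly_Mapping.keys p. Poly_Mapping.single m (Poly_Mapping.lookup p m))"
  by (rule poly_mapping_eqI)
     (auto simp: lookup_sum lookup_single when_def sum.delta in_keys_iff)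

lemma mpoly_eval_mult: "mpoly_eval (p * q) x = mpoly_eval p x * mpoly_eval q x"
proof -
  let ?K = Poly_Mapping.keys and ?L = Poly_Mapping.lookup
  have "p * q = (\<Sum>m\<in>?K p. Poly_Mapping.single m (?L p m)) *
                (\<Sum>m\<in>?K q. Poly_Mapping.single m (?L q m))"
    by (rule arg_cong2[where f = "(*)", OF mpoly_as_sum mpoly_as_sum])
  also have "\<dots> = (\<Sum>m\<in>?K p. \<Sum>m'\<in>?K q. Poly_Mapping.single (m + m') (?L p m * ?L q m'))"
    by (simp add: sum_product mult_single)
  finally have eq: "p * q = \<dots>" .
  show ?thesis
    unfolding eq
    by (simp add: mpoly_eval_sum monom_eval_add mpoly_eval_def[of p] mpoly_eval_def[of q]
        sum_product mult_ac)
qed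

lemma mpolys_mult: "p \<in> mpolys I \<Longrightarrow> q \<in> mpolys I \<Longrightarrow> p * q \<in> mpolys I"
proof -
  assume p: "p \<in> mpolys I" and q: "q \<in> mpolys I"
  have "Poly_Mapping.keys m \<subseteq> I" if pq: "m \<in> Poly_Mapping.keys (p * q)" for m
  proof -
    obtain a b where m: "m = a + b" and "a \<in> Poly_Mapping.keys p" "b \<in> Poly_Mapping.keys q"
      using subsetD[OF keys_mult pq] by blast
    then have "Poly_Mapping.keys a \<subseteq> I" "Poly_Mapping.keys b \<subseteq> I"
      using p q by (auto simp: mpolys_def)
    then show ?thesis
      unfolding m using keys_add[of a b] by blast
  qed
  then show ?thesis
    by (simp add: mpolys_def)
qed

lemma istopology_zariski:
  "istopology (\<lambda>U. \<exists>S \<subseteq> mpolys I. U = affine_space I - zero_locus I (S :: ('v, 'k::field) mpoly set))"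
  unfolding istopology_def
proof (intro conjI allI impI)
  fix U V :: "('v \<Rightarrow> 'k) set"
  assume "\<exists>S \<subseteq> mpolys I. U = affine_space I - zero_locus I S"
    and "\<exists>S \<subseteq> mpolys I. V = affine_space I - zero_locus I S"
  then obtain S T where S: "S \<subseteq> mpolys I" "U = affine_space I - zero_locus I S"
    and T: "T \<subseteq> mpolys I" "V = affine_space I - zero_locus I T"
    by blast
  let ?P = "{p * q |p q. p \<in> S \<and> q \<in> T}"
  have "?P \<subseteq> mpolys I"
    using S(1) T(1) mpolys_mult by blast
  moreover have "U \<inter> V = affine_space I - zero_locus I ?P"
  proof -
    have "x \<in> zero_locus I ?P \<longleftrightarrow> x \<in> zero_locus I S \<or> x \<in> zero_locus I T" for x
    proof -
      have "(\<forall>r\<in>?P. mpoly_eval r x = 0) \<longleftrightarrow> (\<forall>p\<in>S. \<forall>q\<in>T. mpoly_eval (p * q) x = 0)"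
        by blast
      also have "\<dots> \<longleftrightarrow> (\<forall>p\<in>S. mpoly_eval p x = 0) \<or> (\<forall>q\<in>T. mpoly_eval q x = 0)"
        unfolding mpoly_eval_mult mult_eq_0_iff by blast
      finally show ?thesis
        unfolding zero_locus_def mem_Collect_eq by blast
    qed
    then show ?thesis
      unfolding S(2) T(2) by blast
  qed
  ultimately show "\<exists>S \<subseteq> mpolys I. U \<inter> V = affine_space I - zero_locus I S"
    by blast
next
  fix \<U> :: "('v \<Rightarrow> 'k) set set"
  assume "\<forall>U\<in>\<U>. \<exists>S \<subseteq> mpolys I. U = affine_space I - zero_locus I S"
  then obtain S where S: "\<And>U. U \<in> \<U> \<Longrightarrow> S U \<subseteq> mpolys I \<and> U = affine_space I - zero_locus I (S U)"
    by metis
  let ?S = "\<Union>(S ` \<U>)"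
  have "?S \<subseteq> mpolys I"
    using S by blast
  moreover have "\<Union>\<U> = affine_space I - zero_locus I ?S"
  proof -
    have "\<Union>\<U> = (\<Union>U\<in>\<U>. affine_space I - zero_locus I (S U))"
      using S by auto
    also have "\<dots> = affine_space I - zero_locus I ?S"
      by (auto simp: zero_locus_def)
    finally show ?thesis .
  qed
  ultimately show "\<exists>S \<subseteq> mpolys I. \<Union>\<U> = affine_space I - zero_locus I S"
    by blast
qed

lemma openin_zariski:
  "openin (zariski_topology I) U \<longleftrightarrow> (\<exists>S \<subseteq> mpolys I. U = affine_space I - zero_locus I S)"
  unfolding zariski_topology_def by (rule fun_cong[OF topology_inverse'[OF istopology_zariski]])

lemma topspace_zariski [simp]: "topspace (zariski_topology I) = affine_space I"
proof
  show "topspace (zariski_topology I) \<subseteq> affine_space I"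
    using openin_zariski openin_topspace by blast
  have "{1} \<subseteq> mpolys I" "affine_space I = affine_space I - zero_locus I {1 :: ('a, 'b) mpoly}"
    by (auto simp: mpolys_def zero_locus_def)
  then have "openin (zariski_topology I) (affine_space I :: ('a \<Rightarrow> 'b) set)"
    unfolding openin_zariski by blast
  then show "affine_space I \<subseteq> topspace (zariski_topology I :: ('a \<Rightarrow> 'b) topology)"
    by (rule openin_subset)
qed

lemma closedin_zariski:
  "closedin (zariski_topology I) C \<longleftrightarrow> (\<exists>S \<subseteq> mpolys I. C = zero_locus I S)"
proof -
  have "zero_locus I S \<subseteq> affine_space I" for S :: "('a, 'b) mpoly set"
    by (auto simp: zero_locus_def)
  then have "C \<subseteq> affine_space I \<and> affine_space I - C = affine_space I - zero_locus I S
      \<longleftrightarrow> C = zero_locus I S" for S :: "('a, 'b) mpoly set"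
    by (metis double_diff subset_refl)
  then show ?thesis
    unfolding closedin_def openin_zariski topspace_zariski by metis
qed


text \<open>
  The coordinates on the space of pairs (structure constants, matrix of \<open>\<sigma>\<close>):
  \<open>Alpha i j h\<close> is the coefficient of \<open>e\<^sub>h\<close> in \<open>e\<^sub>i e\<^sub>j\<close>, and \<open>Gamma i j\<close> is the coefficient of
  \<open>e\<^sub>j\<close> in \<open>\<sigma>(e\<^sub>i)\<close>.
\<close>

datatype coord = Alpha nat nat nat | Gamma nat nat

definition coords :: "nat \<Rightarrow> coord set" where
  "coords n = {Alpha i j h |i j h. i \<in> {1..n} \<and> j \<in> {1..n} \<and> h \<in> {1..n}} \<union>
              {Gamma i j |i j. i \<in> {1..n} \<and> j \<in> {1..n}}"

lemma card_coords: "card (coords n) = n ^ 3 + n ^ 2"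
proof -
  let ?N = "{1..n}"
  have 1: "{Alpha i j h |i j h. i \<in> ?N \<and> j \<in> ?N \<and> h \<in> ?N} = (\<lambda>(i, j, h). Alpha i j h) ` (?N \<times> ?N \<times> ?N)"
    and 2: "{Gamma i j |i j. i \<in> ?N \<and> j \<in> ?N} = (\<lambda>(i, j). Gamma i j) ` (?N \<times> ?N)"
    by (auto simp: image_iff)
  have "card ((\<lambda>(i, j, h). Alpha i j h) ` (?N \<times> ?N \<times> ?N)) = n ^ 3"
    by (subst card_image) (auto simp: inj_on_def card_cartesian_product power3_eq_cube)
  moreover have "card ((\<lambda>(i, j). Gamma i j) ` (?N \<times> ?N)) = n ^ 2"
    by (subst card_image) (auto simp: inj_on_def card_cartesian_product power2_eq_square)
  ultimately show ?thesis
    unfolding coords_def 1 2 by (subst card_Un_disjoint) auto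
qed

definition basis_vec :: "nat \<Rightarrow> nat \<Rightarrow> nat \<Rightarrow> 'k::field" where
  "basis_vec n i = (\<lambda>h\<in>{1..n}. if h = i then 1 else 0)"

text \<open>
  \<open>k\<^sup>n\<close> with its addition, the \<^emph>\<open>bilinear\<close> product given on the basis by the structure constants in
  \<open>a\<close>, and \<open>e\<^sub>1\<close> as the candidate for the identity. Since the product is \<open>k\<close>-bilinear by
  construction, this is an associative unital \<open>k\<close>-algebra with identity \<open>e\<^sub>1\<close> iff it is a ring
  (\<open>ring\<close> of HOL-Algebra: associative, unital, not necessarily commutative).
\<close>

definition struct_alg :: "nat \<Rightarrow> (coord \<Rightarrow> 'k::field) \<Rightarrow> (nat \<Rightarrow> 'k) ring" where
  "struct_alg n a =
    \<lparr>carrier = affine_space {1..n},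
     monoid.mult = (\<lambda>x y. \<lambda>h\<in>{1..n}. \<Sum>i=1..n. \<Sum>j=1..n. x i * y j * a (Alpha i j h)),
     one = basis_vec n 1,
     zero = (\<lambda>h\<in>{1..n}. 0),
     add = (\<lambda>x y. \<lambda>h\<in>{1..n}. x h + y h)\<rparr>"

definition struct_sigma :: "nat \<Rightarrow> (coord \<Rightarrow> 'k::field) \<Rightarrow> (nat \<Rightarrow> 'k) \<Rightarrow> (nat \<Rightarrow> 'k)" where
  "struct_sigma n a x = (\<lambda>j\<in>{1..n}. \<Sum>i=1..n. x i * a (Gamma i j))"

text \<open>
  The map \<open>\<sigma>\<close> is \<open>k\<close>-linear by construction, so it is an algebra automorphism iff it is a ring
  automorphism; \<open>ring_iso\<close> includes preservation of the identity and bijectivity.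
\<close>

definition Salg :: "nat \<Rightarrow> (coord \<Rightarrow> 'k::field) set" where
  "Salg n = {a \<in> affine_space (coords n).
     ring (struct_alg n a) \<and>
     struct_sigma n a \<in> ring_iso (struct_alg n a) (struct_alg n a) \<and>
     (\<forall>x\<in>carrier (struct_alg n a). struct_sigma n a (struct_sigma n a x) = x)}"

lemma struct_alg_mult_basis:
  assumes "i \<in> {1..n}" "j \<in> {1..n}"
  shows "basis_vec n i \<otimes>\<^bsub>struct_alg n a\<^esub> basis_vec n j = (\<lambda>h\<in>{1..n}. a (Alpha i j h))"
proof -
  have "(\<Sum>i'=1..n. \<Sum>j'=1..n. basis_vec n i i' * basis_vec n j j' * a (Alpha i' j' h))
      = (\<Sum>i'=1..n. \<Sum>j'=1..n. if j' = j then (if i' = i then a (Alpha i' j' h) else 0) else 0)" for h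
    by (intro sum.cong refl) (auto simp: basis_vec_def)
  then show ?thesis
    using assms by (simp add: struct_alg_def fun_eq_iff)
qed

lemma struct_sigma_basis:
  assumes "i \<in> {1..n}"
  shows "struct_sigma n a (basis_vec n i) = (\<lambda>j\<in>{1..n}. a (Gamma i j))"
proof -
  have "(\<Sum>i'=1..n. basis_vec n i i' * a (Gamma i' j))
      = (\<Sum>i'=1..n. if i' = i then a (Gamma i' j) else 0)" for j
    by (intro sum.cong refl) (auto simp: basis_vec_def)
  then show ?thesis
    using assms by (simp add: struct_sigma_def fun_eq_iff)
qed

lemma struct_alg_mult_scale:
  "(\<lambda>h\<in>{1..n}. c * x h) \<otimes>\<^bsub>struct_alg n a\<^esub> y = (\<lambda>h\<in>{1..n}. c * (x \<otimes>\<^bsub>struct_alg n a\<^esub> y) h)"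
  "x \<otimes>\<^bsub>struct_alg n a\<^esub> (\<lambda>h\<in>{1..n}. c * y h) = (\<lambda>h\<in>{1..n}. c * (x \<otimes>\<^bsub>struct_alg n a\<^esub> y) h)"
proof -
  have "(\<Sum>i=1..n. \<Sum>j=1..n. (\<lambda>h\<in>{1..n}. c * x h) i * y j * a (Alpha i j h))
      = c * (\<Sum>i=1..n. \<Sum>j=1..n. x i * y j * a (Alpha i j h))" for h
    unfolding sum_distrib_left by (intro sum.cong refl) simp
  then show "(\<lambda>h\<in>{1..n}. c * x h) \<otimes>\<^bsub>struct_alg n a\<^esub> y
      = (\<lambda>h\<in>{1..n}. c * (x \<otimes>\<^bsub>struct_alg n a\<^esub> y) h)"
    by (simp add: struct_alg_def restrict_def fun_eq_iff)
  have "(\<Sum>i=1..n. \<Sum>j=1..n. x i * (\<lambda>h\<in>{1..n}. c * y h) j * a (Alpha i j h))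
      = c * (\<Sum>i=1..n. \<Sum>j=1..n. x i * y j * a (Alpha i j h))" for h
    unfolding sum_distrib_left by (intro sum.cong refl) simp
  then show "x \<otimes>\<^bsub>struct_alg n a\<^esub> (\<lambda>h\<in>{1..n}. c * y h)
      = (\<lambda>h\<in>{1..n}. c * (x \<otimes>\<^bsub>struct_alg n a\<^esub> y) h)"
    by (simp add: struct_alg_def restrict_def fun_eq_iff)
qed

lemma struct_sigma_scale:
  "struct_sigma n a (\<lambda>h\<in>{1..n}. c * x h) = (\<lambda>h\<in>{1..n}. c * struct_sigma n a x h)"
proof -
  have "(\<Sum>i=1..n. (\<lambda>h\<in>{1..n}. c * x h) i * a (Gamma i j)) = c * (\<Sum>i=1..n. x i * a (Gamma i j))" for j
    unfolding sum_distrib_left by (intro sum.cong refl) simp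
  then show ?thesis
    by (simp add: struct_sigma_def fun_eq_iff)
qed

end

theory Submission
  imports Defs "Jordan_Normal_Form.Determinant"
begin

text \<open>
  Let \<open>M\<close> be the matrix of \<open>\<sigma>\<close>. As \<open>M\<^sup>2 = 1\<close>, we have \<open>(M + 1) (M - 1) = 0\<close>, so \<open>det (M + 1)\<close>
  vanishes unless \<open>M = 1\<close>, in which case it equals \<open>2\<^sup>n \<noteq> 0\<close>. Hence a polynomial function takes
  only the two values \<open>0\<close> and \<open>2\<^sup>n\<close> on the variety. Both are attained, on the algebra
  \<open>k \<oplus> V\<close> with \<open>V\<^sup>2 = 0\<close>, on which \<open>\<sigma> = c\<close> on \<open>V\<close> is admissible for \<open>c = 1\<close> and for \<open>c = -1\<close>.
  (The trace of \<open>\<sigma>\<close> would not do: in characteristic \<open>p\<close> it only determines \<open>dim A\<^sub>0\<close> modulo \<open>p\<close>.)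
\<close>

section \<open>Polynomial functions and determinants\<close>

text \<open>Asking only for existence of a representing polynomial lets closure properties replace
  explicit polynomials.\<close>

definition poly_fun :: "'v set \<Rightarrow> (('v \<Rightarrow> 'k::comm_semiring_1) \<Rightarrow> 'k) \<Rightarrow> bool" where
  "poly_fun I f \<longleftrightarrow> (\<exists>p\<in>mpolys I. \<forall>x. mpoly_eval p x = f x)"

lemma poly_fun_const: "poly_fun I (\<lambda>x. c)"
  unfolding poly_fun_def
  by (rule bexI[of _ "Poly_Mapping.single 0 c"]) (auto simp: mpolys_def monom_eval_def)

lemma poly_fun_coord: "v \<in> I \<Longrightarrow> poly_fun I (\<lambda>x. x v)"
  unfolding poly_fun_def
  by (rule bexI[of _ "Poly_Mapping.single (Poly_Mapping.single v 1) 1"])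
     (auto simp: mpolys_def monom_eval_def)

lemma poly_fun_add:
  assumes "poly_fun I f" "poly_fun I g"
  shows "poly_fun I (\<lambda>x. f x + g x)"
proof -
  obtain p q where p: "p \<in> mpolys I" "\<And>x. mpoly_eval p x = f x"
    and q: "q \<in> mpolys I" "\<And>x. mpoly_eval q x = g x"
    using assms by (auto simp: poly_fun_def)
  have "p + q \<in> mpolys I"
    using p(1) q(1) keys_add[of p q] unfolding mpolys_def by blast
  with p q show ?thesis
    unfolding poly_fun_def by (intro bexI[of _ "p + q"]) (auto simp: mpoly_eval_add)
qed

lemma poly_fun_mult:
  assumes "poly_fun I f" "poly_fun I g"
  shows "poly_fun I (\<lambda>x. f x * g x)"
  using assms mpolys_mult unfolding poly_fun_def by (metis mpoly_eval_mult)

lemma poly_fun_sum: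
  "(\<And>a. a \<in> A \<Longrightarrow> poly_fun I (f a)) \<Longrightarrow> poly_fun I (\<lambda>x. \<Sum>a\<in>A. f a x)"
  by (induction A rule: infinite_finite_induct) (auto intro: poly_fun_const poly_fun_add)

lemma poly_fun_prod:
  "(\<And>a. a \<in> A \<Longrightarrow> poly_fun I (f a)) \<Longrightarrow> poly_fun I (\<lambda>x. \<Prod>a\<in>A. f a x)"
  by (induction A rule: infinite_finite_induct) (auto intro: poly_fun_const poly_fun_mult)

text \<open>By the Leibniz formula, the determinant is a sum of signed products of entries.\<close>

lemma poly_fun_det:
  fixes M :: "('v \<Rightarrow> 'k::comm_ring_1) \<Rightarrow> 'k mat"
  assumes "\<And>x. M x \<in> carrier_mat n n"
    and "\<And>i j. i < n \<Longrightarrow> j < n \<Longrightarrow> poly_fun I (\<lambda>x. M x $$ (i, j))"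
  shows "poly_fun I (\<lambda>x. det (M x))"
proof -
  have "poly_fun I (\<lambda>x. \<Sum>p | p permutes {0..<n}. signof p * (\<Prod>i = 0..<n. M x $$ (i, p i)))"
    by (intro poly_fun_sum poly_fun_mult poly_fun_const poly_fun_prod assms(2))
       (auto dest: permutes_in_image)
  then show ?thesis
    by (simp add: det_def'[OF assms(1)])
qed

section \<open>Level sets and disconnectedness\<close>

lemma closedin_zariski_level_set:
  fixes f :: "('v \<Rightarrow> 'k::field) \<Rightarrow> 'k"
  assumes "poly_fun I f"
  shows "closedin (zariski_topology I) {x \<in> affine_space I. f x = c}"
proof -
  obtain p where p: "p \<in> mpolys I" "\<And>x. mpoly_eval p x = f x + (- c)"
    using poly_fun_add[OF assms poly_fun_const[of I "- c"]] unfolding poly_fun_def by blast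
  have "{x \<in> affine_space I. f x = c} = zero_locus I {p}"
    by (auto simp: zero_locus_def p(2))
  with p(1) show ?thesis
    unfolding closedin_zariski by blast
qed

text \<open>The fibres over \<open>c\<close> and \<open>d\<close> are closed, nonempty and disjoint,
  and they cover \<open>X\<close>.\<close>

lemma zariski_not_connected_if_two_values:
  fixes f :: "('v \<Rightarrow> 'k::field) \<Rightarrow> 'k"
  assumes X: "X \<subseteq> affine_space I" and f: "poly_fun I f"
    and im: "f ` X = {c, d}" and ne: "c \<noteq> d"
  shows "\<not> connected_space (subtopology (zariski_topology I) X)"
proof -
  define E where "E b = X \<inter> {x \<in> affine_space I. f x = b}" for b
  have top: "topspace (subtopology (zariski_topology I) X) = X"
    using X by auto
  have cl: "closedin (subtopology (zariski_topology I) X) (E b)" for b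
    unfolding E_def closedin_subtopology using closedin_zariski_level_set[OF f] by blast
  obtain x y where "x \<in> X" "f x = c" "y \<in> X" "f y = d"
    using im by (metis imageE insertI1 insertI2)
  then have "E c \<noteq> {}" "E d \<noteq> {}"
    using X unfolding E_def by auto
  moreover have "X \<subseteq> E c \<union> E d" "E c \<inter> E d = {}"
    using X im ne unfolding E_def by auto
  ultimately show ?thesis
    using cl unfolding connected_space_closedin top by blast
qed

section \<open>Involutory matrices and the matrix of \<sigma>\<close>

lemma involution_mat_eq_one_or_det_zero:
  fixes M :: "'k::idom mat"
  assumes M: "M \<in> carrier_mat n n" and sq: "M * M = 1\<^sub>m n"
  shows "M = 1\<^sub>m n \<or> det (M + 1\<^sub>m n) = 0"
proof (rule disjCI)
  assume ndet: "det (M + 1\<^sub>m n) \<noteq> 0"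
  let ?P = "M + 1\<^sub>m n" and ?Q = "M + (- 1\<^sub>m n)"
  have P: "?P \<in> carrier_mat n n" and Q: "?Q \<in> carrier_mat n n"
    using M by auto
  have "?P * ?Q = M * ?Q + 1\<^sub>m n * ?Q"
    using M by (intro add_mult_distrib_mat) auto
  also have "M * ?Q = M * M + M * (- 1\<^sub>m n)"
    using M by (intro mult_add_distrib_mat) auto
  also have "M * (- 1\<^sub>m n) = - M"
    using M by simp
  also have "1\<^sub>m n * ?Q = ?Q"
    using Q by (rule left_mult_one_mat)
  finally have PQ: "?P * ?Q = 0\<^sub>m n n"
    using M unfolding sq by (intro eq_matI) auto
  \<comment> \<open>Multiplying \<open>?P * ?Q = 0\<close> on the left by the adjugate gives
    \<open>det ?P\<close> times \<open>?Q\<close> without inverting \<open>?P\<close>; the nonzero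
    scalar then cancels entrywise in the integral domain.\<close>
  have "adj_mat ?P * (?P * ?Q) = (adj_mat ?P * ?P) * ?Q"
    using adj_mat(1)[OF P] P Q by (intro assoc_mult_mat[symmetric])
  also have "\<dots> = det ?P \<cdot>\<^sub>m ?Q"
    unfolding adj_mat(3)[OF P] using left_mult_one_mat[OF Q] mult_smult_assoc_mat[OF one_carrier_mat Q]
    by simp
  finally have zero: "det ?P \<cdot>\<^sub>m ?Q = 0\<^sub>m n n"
    using PQ adj_mat(1)[OF P] by simp
  show "M = 1\<^sub>m n"
  proof (rule eq_matI)
    fix i j assume ij: "i < dim_row (1\<^sub>m n :: 'k mat)" "j < dim_col (1\<^sub>m n :: 'k mat)"
    have "(det ?P \<cdot>\<^sub>m ?Q) $$ (i, j) = 0"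
      unfolding zero using ij by simp
    then have "?Q $$ (i, j) = 0"
      using ij M ndet by simp
    then show "M $$ (i, j) = 1\<^sub>m n $$ (i, j)"
      using ij M by simp
  qed (use M in auto)
qed

text \<open>Row \<open>i\<close> holds the image of a basis vector, so this is the transpose of the
  column convention. \<open>Suc\<close> passes from matrix indices starting at 0 to coordinates
  starting at 1.\<close>

definition sigma_mat :: "nat \<Rightarrow> (coord \<Rightarrow> 'k::field) \<Rightarrow> 'k mat" where
  "sigma_mat n a = mat n n (\<lambda>(i, j). a (Gamma (Suc i) (Suc j)))"

lemma sigma_mat_carrier [simp]: "sigma_mat n a \<in> carrier_mat n n"
  by (simp add: sigma_mat_def)

text \<open>Entry \<open>(i, j)\<close> of the square is a coordinate of \<sigma> applied twice to a
  basis vector.\<close>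

lemma sigma_mat_square:
  assumes "a \<in> Salg n"
  shows "sigma_mat n a * sigma_mat n a = 1\<^sub>m n"
proof (rule eq_matI)
  fix i j assume "i < dim_row (1\<^sub>m n :: 'a mat)" "j < dim_col (1\<^sub>m n :: 'a mat)"
  then have ij: "i < n" "j < n" by auto
  have "basis_vec n (Suc i) \<in> carrier (struct_alg n a)"
    by (simp add: struct_alg_def affine_space_def basis_vec_def)
  then have "struct_sigma n a (struct_sigma n a (basis_vec n (Suc i))) = basis_vec n (Suc i)"
    using assms by (auto simp: Salg_def)
  then have "struct_sigma n a (\<lambda>j\<in>{1..n}. a (Gamma (Suc i) j)) (Suc j) = basis_vec n (Suc i) (Suc j)"
    using ij by (simp add: struct_sigma_basis)
  then have "(\<Sum>l=1..n. a (Gamma (Suc i) l) * a (Gamma l (Suc j))) = (if i = j then 1 else 0)"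
    using ij by (auto simp: struct_sigma_def basis_vec_def)
  moreover have "(\<Sum>l=1..n. a (Gamma (Suc i) l) * a (Gamma l (Suc j)))
      = (\<Sum>l=0..<n. a (Gamma (Suc i) (Suc l)) * a (Gamma (Suc l) (Suc j)))"
    by (rule sum.reindex_bij_witness[of _ Suc "\<lambda>l. l - 1"]) auto
  ultimately show "(sigma_mat n a * sigma_mat n a) $$ (i, j) = 1\<^sub>m n $$ (i, j)"
    using ij by (simp add: sigma_mat_def scalar_prod_def)
qed (auto simp: sigma_mat_def)

section \<open>The two points of the variety\<close>

text \<open>The algebra with \<open>V\<close> spanned by the basis vectors other than the first,
  which is the identity; \<sigma> acts on \<open>V\<close> as \<open>c\<close>.\<close>

definition null_ext :: "nat \<Rightarrow> 'k::field \<Rightarrow> coord \<Rightarrow> 'k" where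
  "null_ext n c = (\<lambda>v\<in>coords n. case v of
      Alpha i j h \<Rightarrow> if i = 1 \<and> j = h \<or> j = 1 \<and> i = h then 1 else 0
    | Gamma i j \<Rightarrow> if i = j then (if i = 1 then 1 else c) else 0)"

lemma null_ext_mult:
  assumes "h \<in> {1..n}"
  shows "(\<Sum>i=1..n. \<Sum>j=1..n. x i * y j * null_ext n c (Alpha i j h))
       = (if h = 1 then x 1 * y 1 else x 1 * y h + x h * y 1)"
proof -
  \<comment> \<open>Both disjuncts in \<open>null_ext\<close> hold at once exactly when
    \<open>i = j = h = 1\<close>; the second summand is 0 for \<open>h = 1\<close> so that this term
    is not counted twice.\<close>
  have "x i * y j * null_ext n c (Alpha i j h)
      = (if j = h then if i = 1 then x i * y j else 0 else 0)
      + (if j = 1 then if i = h then if h = 1 then 0 else x i * y j else 0 else 0)"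
    if "i \<in> {1..n}" "j \<in> {1..n}" for i j
    using that assms by (auto simp: null_ext_def coords_def)
  then have "(\<Sum>i=1..n. \<Sum>j=1..n. x i * y j * null_ext n c (Alpha i j h))
      = (\<Sum>i=1..n. \<Sum>j=1..n. (if j = h then if i = 1 then x i * y j else 0 else 0)
      + (if j = 1 then if i = h then if h = 1 then 0 else x i * y j else 0 else 0))"
    by (intro sum.cong refl) simp
  also have "\<dots> = (if h = 1 then x 1 * y 1 else x 1 * y h + x h * y 1)"
    using assms by (simp add: sum.distrib)
  finally show ?thesis .
qed

lemma struct_alg_null_ext:
  "struct_alg n (null_ext n c) =
    \<lparr>carrier = affine_space {1..n},
     monoid.mult = (\<lambda>x y. \<lambda>h\<in>{1..n}. if h = 1 then x 1 * y 1 else x 1 * y h + x h * y 1),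
     one = basis_vec n 1,
     zero = (\<lambda>h\<in>{1..n}. 0),
     add = (\<lambda>x y. \<lambda>h\<in>{1..n}. x h + y h)\<rparr>"
  unfolding struct_alg_def
  by (simp add: null_ext_mult cong: restrict_cong del: One_nat_def)

lemma struct_sigma_null_ext:
  "struct_sigma n (null_ext n c) x = (\<lambda>j\<in>{1..n}. if j = 1 then x j else c * x j)"
proof -
  have "(\<Sum>i=1..n. x i * null_ext n c (Gamma i j)) = (if j = 1 then x j else c * x j)"
    if "j \<in> {1..n}" for j
  proof -
    have "(\<Sum>i=1..n. x i * null_ext n c (Gamma i j))
        = (\<Sum>i=1..n. if i = j then if j = 1 then x j else c * x j else 0)"
      using that by (intro sum.cong refl) (auto simp: null_ext_def coords_def)
    then show ?thesis
      using that by simp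
  qed
  then show ?thesis
    unfolding struct_sigma_def by (simp cong: restrict_cong)
qed

lemma affine_space_restrict [simp]: "restrict f I \<in> affine_space I"
  by (simp add: affine_space_def)

lemma affine_space_eqI:
  "x \<in> affine_space I \<Longrightarrow> y \<in> affine_space I \<Longrightarrow> (\<And>v. v \<in> I \<Longrightarrow> x v = y v) \<Longrightarrow> x = y"
  unfolding affine_space_def by (rule PiE_ext)

lemma ring_null_ext:
  assumes "n \<ge> 1"
  shows "ring (struct_alg n (null_ext n (c :: 'k::field)))"
proof (rule ringI)
  let ?R = "struct_alg n (null_ext n c)"
  show "abelian_group ?R"
  proof (rule abelian_groupI)
    fix x assume "x \<in> carrier ?R"
    then show "\<exists>y\<in>carrier ?R. y \<oplus>\<^bsub>?R\<^esub> x = \<zero>\<^bsub>?R\<^esub>"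
      by (intro bexI[of _ "\<lambda>h\<in>{1..n}. - x h"])
         (auto simp: struct_alg_null_ext cong: restrict_cong)
  qed (use assms in \<open>auto simp: struct_alg_null_ext algebra_simps intro!: affine_space_eqI[where I = "{1..n}"]\<close>)
  show "monoid ?R"
    by (rule monoidI)
       (use assms in \<open>auto simp: struct_alg_null_ext basis_vec_def algebra_simps intro!: affine_space_eqI[where I = "{1..n}"]\<close>)
qed (use assms in \<open>auto simp: struct_alg_null_ext algebra_simps intro!: affine_space_eqI[where I = "{1..n}"]\<close>)

text \<open>Since \<open>V\<close> squares to zero, scaling it respects products;
  \<open>c * c = 1\<close> makes \<sigma> its own inverse, hence bijective.\<close>

lemma null_ext_in_Salg:
  fixes c :: "'k::field"
  assumes n: "n \<ge> 1" and c: "c * c = 1"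
  shows "null_ext n c \<in> Salg n"
proof -
  let ?R = "struct_alg n (null_ext n c)" and ?s = "struct_sigma n (null_ext n c)"
  have inv: "?s (?s x) = x" if "x \<in> carrier ?R" for x
    using that c
    by (auto simp: struct_alg_null_ext struct_sigma_null_ext mult.assoc[symmetric]
        intro!: affine_space_eqI[where I = "{1..n}"])
  have closed: "?s x \<in> carrier ?R" for x
    by (simp add: struct_alg_null_ext struct_sigma_null_ext)
  have "bij_betw ?s (carrier ?R) (carrier ?R)"
    by (rule bij_betw_byWitness[of _ ?s]) (use inv closed in auto)
  moreover have "?s \<in> Ring.ring_hom ?R ?R"
    by (rule ring_hom_memI)
       (use n in \<open>auto simp: struct_alg_null_ext struct_sigma_null_ext basis_vec_def algebra_simps
          intro!: affine_space_eqI[where I = "{1..n}"]\<close>)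
  moreover have "null_ext n c \<in> affine_space (coords n)"
    by (simp add: null_ext_def affine_space_def)
  ultimately show ?thesis
    using inv ring_null_ext[OF n, of c] by (simp add: Salg_def ring_iso_def)
qed

lemma sigma_mat_null_ext_eq_one_iff:
  assumes "n \<ge> 2"
  shows "sigma_mat n (null_ext n c) = 1\<^sub>m n \<longleftrightarrow> c = 1"
proof
  assume "sigma_mat n (null_ext n c) = 1\<^sub>m n"
  \<comment> \<open>In matrix indexing, \<open>(1, 1)\<close> is the coefficient of the second basis
    vector in its own image, namely \<open>c\<close>; it exists as \<open>n \<ge> 2\<close>.\<close>
  then have "sigma_mat n (null_ext n c) $$ (1, 1) = 1\<^sub>m n $$ (1, 1)"
    by simp
  then show "c = 1"
    using assms by (simp add: sigma_mat_def null_ext_def coords_def)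
next
  assume "c = 1"
  then show "sigma_mat n (null_ext n c) = 1\<^sub>m n"
    by (intro eq_matI) (auto simp: sigma_mat_def null_ext_def coords_def)
qed

section \<open>Separating the variety by a determinant\<close>

theorem proposition2p9:
  fixes n :: nat
  assumes "CHAR('k::alg_closed_field) \<noteq> 2"
    and "n \<ge> 2"
  shows "\<not> connected_space (subtopology (zariski_topology (coords n)) (Salg n :: (coord \<Rightarrow> 'k) set))"
proof -
  have two: "(2 :: 'k) \<noteq> 0"
  proof
    assume "(2 :: 'k) = 0"
    then have "of_nat 2 = (0 :: 'k)"
      by simp
    \<comment> \<open>The characteristic would be 1 or 2: the former is impossible in a field, the
      latter excluded by assumption.\<close>
    then have "CHAR('k) dvd 2"
      by (simp only: of_nat_eq_0_iff_char_dvd)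
    then have "CHAR('k) = 1"
      using assms(1) by (metis prime_nat_iff two_is_prime_nat)
    then show False
      by simp
  qed
  then have minus_one: "(- 1 :: 'k) \<noteq> 1"
    by (metis add.right_inverse one_add_one)
  define f where "f a = det (sigma_mat n a + 1\<^sub>m n)" for a :: "coord \<Rightarrow> 'k"
  have det_two: "det (1\<^sub>m n + 1\<^sub>m n :: 'k mat) = 2 ^ n"
  proof -
    have "1\<^sub>m n + 1\<^sub>m n = (2 :: 'k) \<cdot>\<^sub>m 1\<^sub>m n"
      by (intro eq_matI) auto
    then show ?thesis
      by simp
  qed
  have f_one: "f a = 2 ^ n" if "sigma_mat n a = 1\<^sub>m n" for a
    unfolding f_def that by (rule det_two)
  have f_zero: "f a = 0" if "a \<in> Salg n" "sigma_mat n a \<noteq> 1\<^sub>m n" for a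
    using involution_mat_eq_one_or_det_zero[OF sigma_mat_carrier sigma_mat_square[OF that(1)]] that(2)
    unfolding f_def by blast
  have pts: "null_ext n 1 \<in> (Salg n :: (coord \<Rightarrow> 'k) set)" "null_ext n (- 1) \<in> (Salg n :: (coord \<Rightarrow> 'k) set)"
    using assms(2) by (auto intro: null_ext_in_Salg)
  have "f (null_ext n 1) = 2 ^ n" "f (null_ext n (- 1)) = 0"
    using f_one f_zero pts minus_one sigma_mat_null_ext_eq_one_iff[OF assms(2)] by blast+
  \<comment> \<open>The inclusion from left to right is the dichotomy for involutions; the two
    sample points show that both values occur.\<close>
  then have "f ` Salg n = {2 ^ n, 0}"
    using f_one f_zero pts by (auto simp: image_iff) metis+
  moreover have "poly_fun (coords n) f"
    unfolding f_def
  proof (rule poly_fun_det)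
    fix i j assume "i < n" "j < n"
    then show "poly_fun (coords n) (\<lambda>a :: coord \<Rightarrow> 'k. (sigma_mat n a + 1\<^sub>m n) $$ (i, j))"
      by (auto simp: sigma_mat_def coords_def intro!: poly_fun_add poly_fun_const poly_fun_coord)
  qed auto
  moreover have "Salg n \<subseteq> (affine_space (coords n) :: (coord \<Rightarrow> 'k) set)"
    by (auto simp: Salg_def)
  \<comment> \<open>The values differ because \<open>2 \<noteq> 0\<close> implies
    \<open>2 ^ n \<noteq> 0\<close>.\<close>
  ultimately show ?thesis
    using two by (intro zariski_not_connected_if_two_values[of _ _ f "2 ^ n" 0]) auto
qed

end
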